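(* Let $\mathcal P=(\mathcal V,\mathcal L,\#,\{\mathcal L_v\}_{v\in\mathcal V},\theta)$ be an instance of the incomplete linear assignment problem (ILAP) and let $\mathcal P'=(\mathcal V',\mathcal L',\{\mathcal L'_v\}_{v\in\mathcal V'},\theta')$ be the LAP instance constructed from $\mathcal P$ as in the context. Let $\mu'$ and $(\alpha',\beta')$ be feasible for the primal LP (P$'$) and the dual LP (D$'$) of $\mathcal P'$, respectively. Define $\mu$ by $$\forall v\in\mathcal V,\ \ell\in\mathcal L_v:\quad \mu_v(\ell)=\begin{cases}(\mu'_v(\ell)+\mu'_\ell(v))/2&\text{if }\ell\ne\#\\ \mu'_v(v)&\text{if }\ell=\#\end{cases}$$ and $(\alpha,\beta)$ by $\alpha_v=\alpha'_v+\beta'_v$ for all $v\in\mathcal V$ and $\beta_\ell=\alpha'_\ell+\beta'_\ell$ for all $\ell\in\mathcal L\setminus\{\#\}$. Then: (a) $\mu$ is feasible for the primal LP (P) of $\mathcal P$; (b) $(\alpha,\beta)$ is feasible for the dual LP (D) of $\mathcal P$; (c) if $\mu'$ is optimal for (P$'$), then $\mu$ is optimal for (P); (d) if $(\alpha',\beta')$ is optimal for (D$'$), then $(\alpha,\beta)$ is optimal for (D); (e) if $\mu'$ is in the relative interior of the set of optimizers of (P$'$), then $\mu$ is in the relative interior of the set of optimizers of (P); (f) if $(\alpha',\beta')$ is in the relative interior of the set of optimizers of (D$'$), then $(\alpha,\beta)$ is in the relative interior of the set of optimizers of (D).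
   Context: **ILAP.** $\mathcal V$ (vertices) and $\mathcal L$ (labels) are finite disjoint sets with a distinguished dummy label $\#\in\mathcal L$. For each $v\in\mathcal V$, $\mathcal L_v\subseteq\mathcal L$ with $\#\in\mathcal L_v$ is the set of allowed labels and $\theta_v\colon\mathcal L_v\to\mathbb R$ a cost function. The ILAP minimizes $\sum_{v\in\mathcal V}\theta_v(x_v)$ over $x\colon\mathcal V\to\mathcal L$ with $x_v\in\mathcal L_v$ for all $v$ and such that each $\ell\in\mathcal L\setminus\{\#\}$ is assigned to at most one vertex. Put $\mathcal V_\ell=\{v\in\mathcal V\mid\ell\in\mathcal L_v\}$. **LPs of the ILAP.** (P): minimize $\sum_{v\in\mathcal V,\ell\in\mathcal L_v}\theta_v(\ell)\mu_v(\ell)$ subject to $\mu_v(\ell)\ge0$ for all $v\in\mathcal V,\ell\in\mathcal L_v$; $\sum_{\ell\in\mathcal L_v}\mu_v(\ell)=1$ for all $v\in\mathcal V$; $\sum_{v\in\mathcal V_\ell}\mu_v(\ell)\le1$ for all $\ell\in\mathcal L\setminus\{\#\}$. (D): maximize $\sum_{v\in\mathcal V}\alpha_v+\sum_{\ell\in\mathcal L\setminus\{\#\}}\beta_\ell$ subject to $\alpha_v+\beta_\ell\le\theta_v(\ell)$ for all $v\in\mathcal V,\ell\in\mathcal L_v\setminus\{\#\}$; $\alpha_v\le\theta_v(\#)$ for all $v\in\mathcal V$; $\alpha_v\in\mathbb R$; $\beta_\ell\le0$ for all $\ell\in\mathcal L\setminus\{\#\}$. **Reduction.** The LAP instance $\mathcal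 P'$ is given by $\mathcal V'=\mathcal L'=\mathcal V\cup\mathcal L\setminus\{\#\}$ (the vertex set $\mathcal V'$ and label set $\mathcal L'$ are regarded as two separate copies of this set); $\mathcal L'_v=(\mathcal L_v\setminus\{\#\})\cup\{v\}$ for $v\in\mathcal V$ and $\mathcal L'_v=\mathcal V_v\cup\{v\}$ for $v\in\mathcal L\setminus\{\#\}$; and for $v\in\mathcal V'$, $\ell\in\mathcal L'_v$: $\theta'_v(\ell)=\theta_v(\ell)/2$ if $v\in\mathcal V,\ell\in\mathcal L$; $\theta'_v(\ell)=\theta_\ell(v)/2$ if $v\in\mathcal L,\ell\in\mathcal V$; $\theta'_v(\ell)=\theta_v(\#)$ if $v,\ell\in\mathcal V$ (so $\ell=v$); $\theta'_v(\ell)=0$ if $v,\ell\in\mathcal L$ (so $\ell=v$). **LPs of the LAP instance $\mathcal P'$.** (P$'$): minimize $\sum_{v\in\mathcal V',\ell\in\mathcal L'_v}\theta'_v(\ell)\mu'_v(\ell)$ subject to $\mu'_v(\ell)\ge0$ for all $v\in\mathcal V',\ell\in\mathcal L'_v$; $\sum_{\ell\in\mathcal L'_v}\mu'_v(\ell)=1$ for all $v\in\mathcal V'$; $\sum_{v\in\mathcal V':\,\ell\in\mathcal L'_v}\mu'_v(\ell)=1$ for all $\ell\in\mathcal L'$. (D$'$): maximize $\sum_{v\in\mathcal V'}\alpha'_v+\sum_{\ell\in\mathcal L'}\beta'_\ell$ over $\alpha'\in\mathbb R^{\mathcal V'},\beta'\in\mathbb R^{\mathcal L'}$ subject to $\alpha'_v+\beta'_\ell\le\theta'_v(\ell)$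 for all $v\in\mathcal V',\ell\in\mathcal L'_v$. *)

theory Defs
  imports "HOL-Analysis.Analysis"
begin

text \<open>
  Vertices and labels live in a common type \<open>'a\<close>, so that \<open>V \<union> L - {#}\<close> is an ordinary union.
  The linear programs take \<open>'a\<close> of class \<open>finite\<close>; any finite disjoint sets of vertices and labels
  (including an empty vertex set) occur as subsets of such a type.
  A vector over a finite index set \<open>I\<close> of vertices, labels or vertex-label pairs is a vector in
  \<open>real ^ 'a\<close> or \<open>real ^ 'a ^ 'a\<close> whose components outside \<open>I\<close> are \<open>0\<close>. This identifies
  the space of vectors over \<open>I\<close> with a linear subspace, and the relative interior of a set does
  not depend on whether it is taken in that subspace or in the surrounding space.
\<close>

record 'a ilap =
  vertices :: "'a set"
  labels :: "'a set"
  dummy :: 'a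
  allowed :: "'a \<Rightarrow> 'a set"
  cost :: "'a \<Rightarrow> 'a \<Rightarrow> real"

record 'a lap =
  lap_vertices :: "'a set"
  lap_labels :: "'a set"
  lap_allowed :: "'a \<Rightarrow> 'a set"
  lap_cost :: "'a \<Rightarrow> 'a \<Rightarrow> real"

text \<open>Only the values \<open>allowed P v\<close> for vertices \<open>v\<close> and \<open>cost P v l\<close> for vertices \<open>v\<close> and
  \<open>l \<in> allowed P v\<close> are part of the instance; the remaining values are arbitrary.\<close>

definition ilap_instance :: "'a ilap \<Rightarrow> bool" where
  "ilap_instance P \<longleftrightarrow>
     finite (vertices P) \<and> finite (labels P) \<and> vertices P \<inter> labels P = {} \<and>
     dummy P \<in> labels P \<and>
     (\<forall>v\<in>vertices P. allowed P v \<subseteq> labels P \<and> dummy P \<in> allowed P v)"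

definition proper_labels :: "'a ilap \<Rightarrow> 'a set" where
  "proper_labels P = labels P - {dummy P}"

definition vertices_allowing :: "'a ilap \<Rightarrow> 'a \<Rightarrow> 'a set" where
  "vertices_allowing P l = {v \<in> vertices P. l \<in> allowed P v}"

definition ilap_primal_feasible :: "'a::finite ilap \<Rightarrow> real ^ 'a ^ 'a \<Rightarrow> bool" where
  "ilap_primal_feasible P \<mu> \<longleftrightarrow>
     (\<forall>v l. \<not> (v \<in> vertices P \<and> l \<in> allowed P v) \<longrightarrow> \<mu> $ v $ l = 0) \<and>
     (\<forall>v\<in>vertices P. \<forall>l\<in>allowed P v. \<mu> $ v $ l \<ge> 0) \<and>
     (\<forall>v\<in>vertices P. (\<Sum>l\<in>allowed P v. \<mu> $ v $ l) = 1) \<and>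
     (\<forall>l\<in>proper_labels P. (\<Sum>v\<in>vertices_allowing P l. \<mu> $ v $ l) \<le> 1)"

definition ilap_primal_objective :: "'a::finite ilap \<Rightarrow> real ^ 'a ^ 'a \<Rightarrow> real" where
  "ilap_primal_objective P \<mu> = (\<Sum>v\<in>vertices P. \<Sum>l\<in>allowed P v. cost P v l * \<mu> $ v $ l)"

definition ilap_primal_optimizers :: "'a::finite ilap \<Rightarrow> (real ^ 'a ^ 'a) set" where
  "ilap_primal_optimizers P =
     {\<mu>. is_arg_min (ilap_primal_objective P) (ilap_primal_feasible P) \<mu>}"

definition ilap_dual_feasible :: "'a::finite ilap \<Rightarrow> (real ^ 'a) \<times> (real ^ 'a) \<Rightarrow> bool" where
  "ilap_dual_feasible P = (\<lambda>(\<alpha>, \<beta>).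
     (\<forall>v. v \<notin> vertices P \<longrightarrow> \<alpha> $ v = 0) \<and>
     (\<forall>l. l \<notin> proper_labels P \<longrightarrow> \<beta> $ l = 0) \<and>
     (\<forall>v\<in>vertices P. \<forall>l\<in>allowed P v - {dummy P}. \<alpha> $ v + \<beta> $ l \<le> cost P v l) \<and>
     (\<forall>v\<in>vertices P. \<alpha> $ v \<le> cost P v (dummy P)) \<and>
     (\<forall>l\<in>proper_labels P. \<beta> $ l \<le> 0))"

definition ilap_dual_objective :: "'a::finite ilap \<Rightarrow> (real ^ 'a) \<times> (real ^ 'a) \<Rightarrow> real" where
  "ilap_dual_objective P = (\<lambda>(\<alpha>, \<beta>). (\<Sum>v\<in>vertices P. \<alpha> $ v) + (\<Sum>l\<in>proper_labels P. \<beta> $ l))"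

definition ilap_dual_optimizers :: "'a::finite ilap \<Rightarrow> ((real ^ 'a) \<times> (real ^ 'a)) set" where
  "ilap_dual_optimizers P =
     {d. is_arg_max (ilap_dual_objective P) (ilap_dual_feasible P) d}"

definition lap_primal_feasible :: "'a::finite lap \<Rightarrow> real ^ 'a ^ 'a \<Rightarrow> bool" where
  "lap_primal_feasible Q \<mu> \<longleftrightarrow>
     (\<forall>v l. \<not> (v \<in> lap_vertices Q \<and> l \<in> lap_allowed Q v) \<longrightarrow> \<mu> $ v $ l = 0) \<and>
     (\<forall>v\<in>lap_vertices Q. \<forall>l\<in>lap_allowed Q v. \<mu> $ v $ l \<ge> 0) \<and>
     (\<forall>v\<in>lap_vertices Q. (\<Sum>l\<in>lap_allowed Q v. \<mu> $ v $ l) = 1) \<and>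
     (\<forall>l\<in>lap_labels Q. (\<Sum>v\<in>{v \<in> lap_vertices Q. l \<in> lap_allowed Q v}. \<mu> $ v $ l) = 1)"

definition lap_primal_objective :: "'a::finite lap \<Rightarrow> real ^ 'a ^ 'a \<Rightarrow> real" where
  "lap_primal_objective Q \<mu> =
     (\<Sum>v\<in>lap_vertices Q. \<Sum>l\<in>lap_allowed Q v. lap_cost Q v l * \<mu> $ v $ l)"

definition lap_primal_optimizers :: "'a::finite lap \<Rightarrow> (real ^ 'a ^ 'a) set" where
  "lap_primal_optimizers Q =
     {\<mu>. is_arg_min (lap_primal_objective Q) (lap_primal_feasible Q) \<mu>}"

definition lap_dual_feasible :: "'a::finite lap \<Rightarrow> (real ^ 'a) \<times> (real ^ 'a) \<Rightarrow> bool" where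
  "lap_dual_feasible Q = (\<lambda>(\<alpha>, \<beta>).
     (\<forall>v. v \<notin> lap_vertices Q \<longrightarrow> \<alpha> $ v = 0) \<and>
     (\<forall>l. l \<notin> lap_labels Q \<longrightarrow> \<beta> $ l = 0) \<and>
     (\<forall>v\<in>lap_vertices Q. \<forall>l\<in>lap_allowed Q v. \<alpha> $ v + \<beta> $ l \<le> lap_cost Q v l))"

definition lap_dual_objective :: "'a::finite lap \<Rightarrow> (real ^ 'a) \<times> (real ^ 'a) \<Rightarrow> real" where
  "lap_dual_objective Q =
     (\<lambda>(\<alpha>, \<beta>). (\<Sum>v\<in>lap_vertices Q. \<alpha> $ v) + (\<Sum>l\<in>lap_labels Q. \<beta> $ l))"

definition lap_dual_optimizers :: "'a::finite lap \<Rightarrow> ((real ^ 'a) \<times> (real ^ 'a)) set" where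
  "lap_dual_optimizers Q =
     {d. is_arg_max (lap_dual_objective Q) (lap_dual_feasible Q) d}"

text \<open>The vertex set and the label set of the reduced instance are the same set. They are kept apart
  by position: in \<open>\<mu> $ v $ l\<close>, \<open>lap_cost Q v l\<close> and \<open>(\<alpha>, \<beta>)\<close> the vertices come first.\<close>

definition reduction :: "'a ilap \<Rightarrow> 'a lap" where
  "reduction P =
     \<lparr> lap_vertices = vertices P \<union> proper_labels P,
       lap_labels = vertices P \<union> proper_labels P,
       lap_allowed = (\<lambda>v.
         if v \<in> vertices P then (allowed P v - {dummy P}) \<union> {v}
         else vertices_allowing P v \<union> {v}),
       lap_cost = (\<lambda>v l.
         if v \<in> vertices P \<and> l \<in> labels P then cost P v l / 2
         else if v \<in> labels P \<and> l \<in> vertices P then cost P l v / 2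
         else if v \<in> vertices P \<and> l \<in> vertices P then cost P v (dummy P)
         else 0) \<rparr>"

end

theory Submission
  imports Defs
begin

text \<open>
  The maps \<open>\<mu>' \<mapsto> \<mu>\<close> and \<open>(\<alpha>', \<beta>') \<mapsto> (\<alpha>, \<beta>)\<close> are linear, preserve the objective,
  and map the feasible set of the reduced program \<^emph>\<open>onto\<close> that of the original one.
  For surjectivity, \<open>\<mu>\<close> is lifted to the symmetric matrix with entries \<open>\<mu>\<^sub>v(l)\<close> off the diagonal,
  \<open>\<mu>\<^sub>v(#)\<close> on the diagonal at vertices and the slack of the constraint of \<open>l\<close> on the diagonal at
  labels; a dual point is lifted to \<open>(\<gamma>, \<gamma>)\<close> with \<open>\<gamma> = (\<alpha> + \<beta>)/2\<close>.
  Hence optimizers are mapped onto optimizers, and relative interiors of convex sets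
  commute with linear images.
\<close>

section \<open>Optimizers under objective-preserving maps\<close>

lemma is_arg_max_iff_is_arg_min:
  fixes f :: "'a \<Rightarrow> real"
  shows "is_arg_max f F x \<longleftrightarrow> is_arg_min (\<lambda>y. - f y) F x"
  by (auto simp: is_arg_max_def is_arg_min_def)

text \<open>\<open>T\<close> carries values over unchanged and is onto, so both problems attain the
  same values. Hence images of minimizers are minimizers, and any feasible preimage of a minimizer
  is one.\<close>

lemma arg_min_image:
  fixes g :: "'b \<Rightarrow> real"
  assumes "T ` {x. F x} = {y. G y}" and "\<And>x. F x \<Longrightarrow> g (T x) = f x"
  shows "T ` {x. is_arg_min f F x} = {y. is_arg_min g G y}"
proof -
  have G: "G y \<longleftrightarrow> (\<exists>x. F x \<and> T x = y)" for y
  proof -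
    have "y \<in> T ` {x. F x} \<longleftrightarrow> G y" using assms(1) by simp
    then show ?thesis by auto
  qed
  show ?thesis
  proof (intro equalityI subsetI)
    fix y assume "y \<in> T ` {x. is_arg_min f F x}"
    then obtain x where "is_arg_min f F x" "y = T x" by auto
    then show "y \<in> {y. is_arg_min g G y}"
      by (auto simp: is_arg_min_def G assms(2))
  next
    fix y assume "y \<in> {y. is_arg_min g G y}"
    then have y: "G y" "\<And>z. G z \<Longrightarrow> \<not> g z < g y" by (auto simp: is_arg_min_def)
    then obtain x where x: "F x" "T x = y" by (auto simp: G)
    have "is_arg_min f F x"
      unfolding is_arg_min_def using x y(2) G assms(2) by metis
    then show "y \<in> T ` {x. is_arg_min f F x}" using x by auto
  qed
qed

text \<open>Two minimizers share the minimal value, and a linear objective keeps that value on their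
  convex combinations, which stay feasible.\<close>

lemma convex_arg_min:
  fixes f :: "'a::real_vector \<Rightarrow> real"
  assumes "linear f" "convex {x. F x}"
  shows "convex {x. is_arg_min f F x}"
proof (rule convexI)
  fix x y and u v :: real
  assume xy: "x \<in> {x. is_arg_min f F x}" "y \<in> {x. is_arg_min f F x}"
    and uv: "0 \<le> u" "0 \<le> v" "u + v = 1"
  have F: "F (u *\<^sub>R x + v *\<^sub>R y)"
    using convexD[OF assms(2) _ _ uv, of x y] xy by (auto simp: is_arg_min_def)
  have "f x = f y" using xy by (auto simp: is_arg_min_def not_less intro: antisym)
  then have "f (u *\<^sub>R x + v *\<^sub>R y) = (u + v) * f x"
    using assms(1) by (simp add: linear_add linear_cmul algebra_simps)
  then have "f (u *\<^sub>R x + v *\<^sub>R y) = f x" using uv by simp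
  then show "u *\<^sub>R x + v *\<^sub>R y \<in> {x. is_arg_min f F x}"
    using F xy by (auto simp: is_arg_min_def)
qed

text \<open>Relative interior commutes with linear images of convex sets. The convex set here is the
  set of minimizers, so the image of minimizers under \<open>T\<close> carries over to relative
  interiors.\<close>

lemma rel_interior_arg_min_image:
  fixes T :: "'a::euclidean_space \<Rightarrow> 'b::euclidean_space" and f :: "'a \<Rightarrow> real"
  assumes "linear T" "linear f" "convex {x. F x}"
    and "T ` {x. F x} = {y. G y}" "\<And>x. F x \<Longrightarrow> g (T x) = f x"
  shows "T ` rel_interior {x. is_arg_min f F x} = rel_interior {y. is_arg_min g G y}"
proof -
  have "T ` {x. is_arg_min f F x} = {y. is_arg_min g G y}"
    by (rule arg_min_image) (use assms in auto)
  then show ?thesis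
    using rel_interior_convex_linear_image[OF assms(1) convex_arg_min[OF assms(2,3)]] by simp
qed

section \<open>Linearity and convexity of the LAP programs\<close>

lemma linear_lap_primal_objective: "linear (lap_primal_objective Q)"
  by (rule linearI)
    (auto simp: lap_primal_objective_def algebra_simps sum.distrib sum_distrib_left)

lemma linear_lap_dual_objective: "linear (lap_dual_objective Q)"
  by (rule linearI)
    (auto simp: lap_dual_objective_def algebra_simps sum.distrib sum_distrib_left split: prod.splits)

lemma convex_lap_primal_feasible: "convex {x. lap_primal_feasible Q x}"
  by (rule convexI) (auto simp: lap_primal_feasible_def sum.distrib sum_distrib_left[symmetric])

lemma convex_lap_dual_feasible: "convex {x. lap_dual_feasible Q x}"
proof (rule convexI, clarsimp simp: lap_dual_feasible_def)
  fix a b c d :: "real ^ 'a" and u v :: real and i j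
  assume uv: "0 \<le> u" "0 \<le> v" "u + v = 1"
    and "\<forall>v\<in>lap_vertices Q. \<forall>l\<in>lap_allowed Q v. a $ v + b $ l \<le> lap_cost Q v l"
    and "\<forall>v\<in>lap_vertices Q. \<forall>l\<in>lap_allowed Q v. c $ v + d $ l \<le> lap_cost Q v l"
    and ij: "i \<in> lap_vertices Q" "j \<in> lap_allowed Q i"
  then have "u * (a $ i + b $ j) + v * (c $ i + d $ j) \<le> lap_cost Q i j"
    by (intro convex_bound_le) auto
  then show "u * a $ i + v * c $ i + (u * b $ j + v * d $ j) \<le> lap_cost Q i j"
    by (simp add: algebra_simps)
qed

section \<open>Projections to the ILAP programs and their right inverses\<close>

definition project_primal :: "'a::finite ilap \<Rightarrow> real ^ 'a ^ 'a \<Rightarrow> real ^ 'a ^ 'a" where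
  "project_primal P \<mu>' = (\<chi> v l. if v \<in> vertices P \<and> l \<in> allowed P v
     then (if l \<noteq> dummy P then (\<mu>' $ v $ l + \<mu>' $ l $ v) / 2 else \<mu>' $ v $ v)
     else 0)"

definition project_dual ::
    "'a::finite ilap \<Rightarrow> (real ^ 'a) \<times> (real ^ 'a) \<Rightarrow> (real ^ 'a) \<times> (real ^ 'a)" where
  "project_dual P = (\<lambda>(\<alpha>', \<beta>').
     (\<chi> v. if v \<in> vertices P then \<alpha>' $ v + \<beta>' $ v else 0,
      \<chi> l. if l \<in> proper_labels P then \<alpha>' $ l + \<beta>' $ l else 0))"

text \<open>Symmetry turns the column equations into copies of the row equations, and averaging an
  entry with its transpose then gives the entry back. The diagonal holds exactly the mass that each
  row lacks to sum to 1.\<close>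

definition lift_primal :: "'a::finite ilap \<Rightarrow> real ^ 'a ^ 'a \<Rightarrow> real ^ 'a ^ 'a" where
  "lift_primal P \<mu> = (\<chi> v l.
     if v \<in> vertices P \<and> l \<in> allowed P v - {dummy P} then \<mu> $ v $ l
     else if l \<in> vertices P \<and> v \<in> allowed P l - {dummy P} then \<mu> $ l $ v
     else if v = l \<and> v \<in> vertices P then \<mu> $ v $ dummy P
     else if v = l \<and> v \<in> proper_labels P then 1 - (\<Sum>w\<in>vertices_allowing P v. \<mu> $ w $ v)
     else 0)"

text \<open>For feasible points \<open>\<alpha>\<close> vanishes outside the vertices and
  \<open>\<beta>\<close> outside the proper labels, so \<open>\<alpha> + \<beta>\<close> glues them
  into one vector on the union. The factor 1/2 makes the two equal copies add up to it.\<close>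

definition lift_dual ::
    "(real ^ 'a::finite) \<times> (real ^ 'a) \<Rightarrow> (real ^ 'a) \<times> (real ^ 'a)" where
  "lift_dual = (\<lambda>(\<alpha>, \<beta>). let \<gamma> = (1/2) *\<^sub>R (\<alpha> + \<beta>) in (\<gamma>, \<gamma>))"

lemma linear_project_primal: "linear (project_primal P)"
  by (rule linearI) (auto simp: project_primal_def vec_eq_iff algebra_simps add_divide_distrib)

lemma linear_project_dual: "linear (project_dual P)"
  by (rule linearI) (auto simp: project_dual_def vec_eq_iff algebra_simps split: prod.splits)

section \<open>Structure of the reduced instance\<close>

context
  fixes P :: "'a::finite ilap"
  assumes instance_P: "ilap_instance P"
begin

private abbreviation (input) "V \<equiv> vertices P"
private abbreviation (input) "L \<equiv> proper_labels P"
private abbreviation (input) "R \<equiv> reduction P"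

lemma vertices_notin_labels: "v \<in> V \<Longrightarrow> v \<notin> labels P" "v \<in> V \<Longrightarrow> v \<notin> L"
  using instance_P by (auto simp: ilap_instance_def proper_labels_def)

lemma labels_notin_vertices: "l \<in> labels P \<Longrightarrow> l \<notin> V" "l \<in> L \<Longrightarrow> l \<notin> V"
  using vertices_notin_labels by auto

lemma allowed_labels: "v \<in> V \<Longrightarrow> l \<in> allowed P v \<Longrightarrow> l \<in> labels P"
  using instance_P by (auto simp: ilap_instance_def)

lemma dummy_not_proper: "dummy P \<notin> L"
  by (simp add: proper_labels_def)

lemma dummy_allowed: "v \<in> V \<Longrightarrow> dummy P \<in> allowed P v"
  using instance_P by (auto simp: ilap_instance_def)

lemma allowed_proper: "v \<in> V \<Longrightarrow> allowed P v - {dummy P} = {l \<in> L. l \<in> allowed P v}"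
  using allowed_labels by (auto simp: proper_labels_def)

lemma reduction_sets [simp]: "lap_vertices R = V \<union> L" "lap_labels R = V \<union> L"
  by (simp_all add: reduction_def)

lemma reduction_allowed:
  "v \<in> V \<Longrightarrow> lap_allowed R v = insert v (allowed P v - {dummy P})"
  "l \<in> L \<Longrightarrow> lap_allowed R l = insert l (vertices_allowing P l)"
  using labels_notin_vertices by (auto simp: reduction_def)

lemma reduction_cost:
  "v \<in> V \<Longrightarrow> l \<in> L \<Longrightarrow> lap_cost R v l = cost P v l / 2"
  "v \<in> V \<Longrightarrow> l \<in> L \<Longrightarrow> lap_cost R l v = cost P v l / 2"
  "v \<in> V \<Longrightarrow> lap_cost R v v = cost P v (dummy P)"
  "l \<in> L \<Longrightarrow> lap_cost R l l = 0"
  using vertices_notin_labels by (auto simp: reduction_def proper_labels_def)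

text \<open>Being allowed is a symmetric relation in the reduced instance: \<open>l\<close> is
  allowed at \<open>v\<close> iff \<open>v\<close> is allowed at \<open>l\<close>. Column sums
  therefore range over the same index sets as row sums.\<close>

lemma reduction_coallowed:
  assumes "l \<in> V \<union> L"
  shows "{v \<in> V \<union> L. l \<in> lap_allowed R v} = lap_allowed R l"
  using assms vertices_notin_labels allowed_labels
  by (auto simp: reduction_def vertices_allowing_def proper_labels_def)

lemma sum_allowed:
  fixes f :: "'a \<Rightarrow> real"
  shows "v \<in> V \<Longrightarrow> sum f (allowed P v) = f (dummy P) + sum f (allowed P v - {dummy P})"
  using dummy_allowed by (subst sum.remove[of _ "dummy P"]) auto

lemma sum_reduction_allowed_vertex:
  fixes f :: "'a \<Rightarrow> real"
  assumes "v \<in> V"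
  shows "sum f (lap_allowed R v) = f v + sum f (allowed P v - {dummy P})"
proof -
  have "v \<notin> allowed P v" using assms allowed_labels vertices_notin_labels by blast
  then show ?thesis by (simp add: reduction_allowed(1)[OF assms])
qed

lemma sum_reduction_allowed_label:
  fixes f :: "'a \<Rightarrow> real"
  assumes "l \<in> L"
  shows "sum f (lap_allowed R l) = f l + sum f (vertices_allowing P l)"
proof -
  have "l \<notin> vertices_allowing P l"
    using assms labels_notin_vertices by (auto simp: vertices_allowing_def)
  then show ?thesis by (simp add: reduction_allowed(2)[OF assms])
qed

lemma sum_vertices_labels:
  fixes f :: "'a \<Rightarrow> real"
  shows "sum f (V \<union> L) = sum f V + sum f L"
  by (rule sum.union_disjoint) (auto dest: vertices_notin_labels)

text \<open>Both sides run over all pairs of a vertex and a proper label allowed at it, grouped by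
  label or by vertex.\<close>

lemma sum_swap_allowed:
  fixes f :: "'a \<Rightarrow> 'a \<Rightarrow> real"
  shows "(\<Sum>l\<in>L. \<Sum>v\<in>vertices_allowing P l. f v l) = (\<Sum>v\<in>V. \<Sum>l\<in>allowed P v - {dummy P}. f v l)"
proof -
  \<comment> \<open>The inner index set is written as a filter on the fixed set \<open>L\<close>, so
    that the two sums can be interchanged.\<close>
  have "(\<Sum>v\<in>V. \<Sum>l\<in>allowed P v - {dummy P}. f v l) = (\<Sum>v\<in>V. \<Sum>l | l \<in> L \<and> l \<in> allowed P v. f v l)"
    by (rule sum.cong[OF refl]) (simp add: allowed_proper)
  also have "\<dots> = (\<Sum>l\<in>L. \<Sum>v | v \<in> V \<and> l \<in> allowed P v. f v l)"
    by (rule sum.swap_restrict) auto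
  finally show ?thesis by (simp add: vertices_allowing_def)
qed

section \<open>The primal programs\<close>

lemma lap_primal_feasible_reduction_iff:
  "lap_primal_feasible R m \<longleftrightarrow>
     (\<forall>v l. \<not> (v \<in> V \<union> L \<and> l \<in> lap_allowed R v) \<longrightarrow> m $ v $ l = 0) \<and>
     (\<forall>v l. m $ v $ l \<ge> 0) \<and>
     (\<forall>v\<in>V. m $ v $ v + (\<Sum>l\<in>allowed P v - {dummy P}. m $ v $ l) = 1) \<and>
     (\<forall>l\<in>L. m $ l $ l + (\<Sum>v\<in>vertices_allowing P l. m $ l $ v) = 1) \<and>
     (\<forall>v\<in>V. m $ v $ v + (\<Sum>l\<in>allowed P v - {dummy P}. m $ l $ v) = 1) \<and>
     (\<forall>l\<in>L. m $ l $ l + (\<Sum>v\<in>vertices_allowing P l. m $ v $ l) = 1)"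
proof -
  have rows: "(\<forall>v\<in>V \<union> L. (\<Sum>l\<in>lap_allowed R v. m $ v $ l) = 1) \<longleftrightarrow>
      (\<forall>v\<in>V. m $ v $ v + (\<Sum>l\<in>allowed P v - {dummy P}. m $ v $ l) = 1) \<and>
      (\<forall>l\<in>L. m $ l $ l + (\<Sum>v\<in>vertices_allowing P l. m $ l $ v) = 1)"
    by (auto simp: sum_reduction_allowed_vertex sum_reduction_allowed_label ball_Un)
  have "(\<forall>l\<in>V \<union> L. (\<Sum>v\<in>{v \<in> V \<union> L. l \<in> lap_allowed R v}. m $ v $ l) = 1) \<longleftrightarrow>
      (\<forall>l\<in>V \<union> L. (\<Sum>v\<in>lap_allowed R l. m $ v $ l) = 1)"
    by (intro ball_cong refl) (simp only: reduction_coallowed)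
  also have "\<dots> \<longleftrightarrow>
      (\<forall>v\<in>V. m $ v $ v + (\<Sum>l\<in>allowed P v - {dummy P}. m $ l $ v) = 1) \<and>
      (\<forall>l\<in>L. m $ l $ l + (\<Sum>v\<in>vertices_allowing P l. m $ v $ l) = 1)"
    by (auto simp: sum_reduction_allowed_vertex sum_reduction_allowed_label ball_Un)
  finally have cols: "(\<forall>l\<in>V \<union> L. (\<Sum>v\<in>{v \<in> V \<union> L. l \<in> lap_allowed R v}. m $ v $ l) = 1) \<longleftrightarrow> \<dots>" .
  \<comment> \<open>Entries off the support are 0, so nonnegativity may be stated for all pairs.
    This covers transposed entries without checking that they are allowed.\<close>
  have nonneg: "(\<forall>v l. \<not> (v \<in> V \<union> L \<and> l \<in> lap_allowed R v) \<longrightarrow> m $ v $ l = 0) \<Longrightarrow>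
      (\<forall>v\<in>V \<union> L. \<forall>l\<in>lap_allowed R v. m $ v $ l \<ge> 0) \<longleftrightarrow> (\<forall>v l. m $ v $ l \<ge> 0)"
    by (metis order_refl)
  show ?thesis
    unfolding lap_primal_feasible_def reduction_sets rows cols using nonneg by blast
qed

lemma project_primal_feasible:
  assumes "lap_primal_feasible R m"
  shows "ilap_primal_feasible P (project_primal P m)"
proof -
  note m = assms[unfolded lap_primal_feasible_reduction_iff]
  have row: "(\<Sum>l\<in>allowed P v. project_primal P m $ v $ l) = 1" if v: "v \<in> V" for v
  proof -
    have "(\<Sum>l\<in>allowed P v. project_primal P m $ v $ l)
        = m $ v $ v + (\<Sum>l\<in>allowed P v - {dummy P}. (m $ v $ l + m $ l $ v) / 2)"
      using v dummy_allowed by (simp add: sum_allowed project_primal_def)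
    \<comment> \<open>The projected row sum at \<open>v\<close> is the mean of the row sum and the
      column sum of \<open>m\<close> at \<open>v\<close>, both equal to 1.\<close>
    also have "\<dots> = ((m $ v $ v + (\<Sum>l\<in>allowed P v - {dummy P}. m $ v $ l))
        + (m $ v $ v + (\<Sum>l\<in>allowed P v - {dummy P}. m $ l $ v))) / 2"
      by (simp add: sum.distrib sum_divide_distrib[symmetric] field_simps)
    also have "\<dots> = 1" using m v by simp
    finally show ?thesis .
  qed
  have col: "(\<Sum>v\<in>vertices_allowing P l. project_primal P m $ v $ l) \<le> 1" if l: "l \<in> L" for l
  proof -
    have "(\<Sum>v\<in>vertices_allowing P l. project_primal P m $ v $ l)
        = (\<Sum>v\<in>vertices_allowing P l. (m $ v $ l + m $ l $ v) / 2)"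
      by (rule sum.cong) (use l dummy_not_proper in \<open>auto simp: project_primal_def vertices_allowing_def\<close>)
    \<comment> \<open>Again a mean of a row sum and a column sum, but the diagonal entry at a label
      has no counterpart in the projection and is subtracted. It is thus the slack of the constraint
      of \<open>l\<close>.\<close>
    also have "\<dots> = ((m $ l $ l + (\<Sum>v\<in>vertices_allowing P l. m $ l $ v))
        + (m $ l $ l + (\<Sum>v\<in>vertices_allowing P l. m $ v $ l))) / 2 - m $ l $ l"
      by (simp add: sum.distrib sum_divide_distrib[symmetric] field_simps)
    also have "\<dots> = 1 - m $ l $ l" using m l by simp
    also have "\<dots> \<le> 1" using m by simp
    finally show ?thesis .
  qed
  show ?thesis
    unfolding ilap_primal_feasible_def using row col m
    by (auto simp: project_primal_def)
qed

text \<open>Each cost of a vertex and a proper label is split in halves between an entry and its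
  transpose, which the projection averages. A vertex diagonal carries the full dummy cost, a label
  diagonal costs nothing.\<close>

lemma project_primal_objective:
  "ilap_primal_objective P (project_primal P m) = lap_primal_objective R m"
proof -
  let ?A = "\<lambda>v. allowed P v - {dummy P}"
  have "lap_primal_objective R m
      = (\<Sum>v\<in>V. \<Sum>l\<in>lap_allowed R v. lap_cost R v l * m $ v $ l)
        + (\<Sum>l\<in>L. \<Sum>v\<in>lap_allowed R l. lap_cost R l v * m $ l $ v)"
    by (simp add: lap_primal_objective_def sum_vertices_labels)
  also have "(\<Sum>v\<in>V. \<Sum>l\<in>lap_allowed R v. lap_cost R v l * m $ v $ l)
      = (\<Sum>v\<in>V. cost P v (dummy P) * m $ v $ v + (\<Sum>l\<in>?A v. cost P v l / 2 * m $ v $ l))"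
    by (rule sum.cong[OF refl])
      (simp add: sum_reduction_allowed_vertex reduction_cost allowed_proper)
  also have "(\<Sum>l\<in>L. \<Sum>v\<in>lap_allowed R l. lap_cost R l v * m $ l $ v)
      = (\<Sum>l\<in>L. \<Sum>v\<in>vertices_allowing P l. cost P v l / 2 * m $ l $ v)"
  proof (rule sum.cong[OF refl])
    fix l assume l: "l \<in> L"
    then have "(\<Sum>v\<in>lap_allowed R l. lap_cost R l v * m $ l $ v)
        = (\<Sum>v\<in>vertices_allowing P l. lap_cost R l v * m $ l $ v)"
      by (simp add: sum_reduction_allowed_label reduction_cost)
    also have "\<dots> = (\<Sum>v\<in>vertices_allowing P l. cost P v l / 2 * m $ l $ v)"
      by (rule sum.cong) (use l in \<open>auto simp: vertices_allowing_def reduction_cost\<close>)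
    finally show "(\<Sum>v\<in>lap_allowed R l. lap_cost R l v * m $ l $ v) = \<dots>" .
  qed
  \<comment> \<open>The label rows are regrouped by vertex, so that the two halves of each cost meet
    in the same sum.\<close>
  also have "\<dots> = (\<Sum>v\<in>V. \<Sum>l\<in>?A v. cost P v l / 2 * m $ l $ v)"
    by (rule sum_swap_allowed)
  also have "(\<Sum>v\<in>V. cost P v (dummy P) * m $ v $ v + (\<Sum>l\<in>?A v. cost P v l / 2 * m $ v $ l)) + \<dots>
      = (\<Sum>v\<in>V. cost P v (dummy P) * m $ v $ v
          + (\<Sum>l\<in>?A v. cost P v l * ((m $ v $ l + m $ l $ v) / 2)))"
    by (simp add: sum.distrib[symmetric] algebra_simps add_divide_distrib)
  also have "\<dots> = ilap_primal_objective P (project_primal P m)"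
    unfolding ilap_primal_objective_def
    by (rule sum.cong[OF refl]) (simp add: sum_allowed dummy_allowed project_primal_def)
  finally show ?thesis by simp
qed

lemma lift_primal_entries:
  "v \<in> V \<Longrightarrow> l \<in> allowed P v \<Longrightarrow> l \<noteq> dummy P \<Longrightarrow> lift_primal P m $ v $ l = m $ v $ l"
  "v \<in> V \<Longrightarrow> l \<in> allowed P v \<Longrightarrow> l \<noteq> dummy P \<Longrightarrow> lift_primal P m $ l $ v = m $ v $ l"
  "v \<in> V \<Longrightarrow> lift_primal P m $ v $ v = m $ v $ dummy P"
  "l \<in> L \<Longrightarrow> lift_primal P m $ l $ l = 1 - (\<Sum>v\<in>vertices_allowing P l. m $ v $ l)"
  by (auto simp: lift_primal_def dest: vertices_notin_labels allowed_labels)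

text \<open>At a vertex, row and column equation both become the equation of that vertex in the
  ILAP. At a label both hold by the choice of the diagonal entry, which is nonnegative because the
  label is used at most once.\<close>

lemma lift_primal_feasible:
  assumes "ilap_primal_feasible P m"
  shows "lap_primal_feasible R (lift_primal P m)"
proof -
  note m = assms[unfolded ilap_primal_feasible_def]
  have support: "lift_primal P m $ v $ l = 0" if "\<not> (v \<in> V \<union> L \<and> l \<in> lap_allowed R v)" for v l
    using that vertices_notin_labels allowed_labels
    by (auto simp: lift_primal_def reduction_def vertices_allowing_def proper_labels_def split: if_splits)
  have nonneg: "lift_primal P m $ v $ l \<ge> 0" for v l
    using m dummy_allowed by (auto simp: lift_primal_def)
  have vertex: "m $ v $ dummy P + (\<Sum>l\<in>allowed P v - {dummy P}. m $ v $ l) = 1" if "v \<in> V" for v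
    using m that by (simp add: sum_allowed[symmetric])
  have label: "(\<Sum>v\<in>vertices_allowing P l. lift_primal P m $ v $ l)
        = (\<Sum>v\<in>vertices_allowing P l. m $ v $ l)"
      "(\<Sum>v\<in>vertices_allowing P l. lift_primal P m $ l $ v)
        = (\<Sum>v\<in>vertices_allowing P l. m $ v $ l)" if "l \<in> L" for l
    using that dummy_not_proper
    by (auto intro!: sum.cong lift_primal_entries simp: vertices_allowing_def)
  show ?thesis
    unfolding lap_primal_feasible_reduction_iff
    using support nonneg vertex label by (auto simp: lift_primal_entries)
qed

text \<open>On allowed pairs the symmetric lift averages back to \<open>m\<close>; elsewhere the
  projection is 0, and so is \<open>m\<close> by feasibility.\<close>

lemma project_lift_primal:
  assumes "ilap_primal_feasible P m"
  shows "project_primal P (lift_primal P m) = m"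
  using assms by (auto simp: vec_eq_iff project_primal_def lift_primal_entries ilap_primal_feasible_def)

lemma project_primal_image:
  "project_primal P ` {m. lap_primal_feasible R m} = {m. ilap_primal_feasible P m}"
proof (intro equalityI subsetI)
  fix m assume "m \<in> {m. ilap_primal_feasible P m}"
  then show "m \<in> project_primal P ` {m. lap_primal_feasible R m}"
    by (intro image_eqI[of _ _ "lift_primal P m"])
      (simp_all add: project_lift_primal lift_primal_feasible)
qed (auto intro: project_primal_feasible)

section \<open>The dual programs\<close>

lemma lap_dual_feasible_reduction_iff:
  "lap_dual_feasible R (a, b) \<longleftrightarrow>
     (\<forall>v. v \<notin> V \<union> L \<longrightarrow> a $ v = 0 \<and> b $ v = 0) \<and>
     (\<forall>v\<in>V. \<forall>l\<in>allowed P v - {dummy P}. a $ v + b $ l \<le> cost P v l / 2) \<and>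
     (\<forall>v\<in>V. \<forall>l\<in>allowed P v - {dummy P}. a $ l + b $ v \<le> cost P v l / 2) \<and>
     (\<forall>v\<in>V. a $ v + b $ v \<le> cost P v (dummy P)) \<and>
     (\<forall>l\<in>L. a $ l + b $ l \<le> 0)"
proof -
  have "(\<forall>v\<in>V. \<forall>l\<in>lap_allowed R v. a $ v + b $ l \<le> lap_cost R v l) \<longleftrightarrow>
      (\<forall>v\<in>V. a $ v + b $ v \<le> cost P v (dummy P)) \<and>
      (\<forall>v\<in>V. \<forall>l\<in>allowed P v - {dummy P}. a $ v + b $ l \<le> cost P v l / 2)"
    using allowed_proper by (fastforce simp: reduction_allowed reduction_cost)
  \<comment> \<open>The label rows give the transposed constraints, again with half the cost and now
    indexed by vertex. Their diagonal, of cost 0, is the source of the sign condition on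
    \<open>\<beta>\<close>.\<close>
  moreover have "(\<forall>l\<in>L. \<forall>v\<in>lap_allowed R l. a $ l + b $ v \<le> lap_cost R l v) \<longleftrightarrow>
      (\<forall>l\<in>L. a $ l + b $ l \<le> 0) \<and>
      (\<forall>v\<in>V. \<forall>l\<in>allowed P v - {dummy P}. a $ l + b $ v \<le> cost P v l / 2)"
    using allowed_proper
    by (fastforce simp: reduction_allowed reduction_cost vertices_allowing_def)
  ultimately show ?thesis
    unfolding lap_dual_feasible_def by (auto simp: ball_Un)
qed

text \<open>Adding the constraints of a pair and of its transpose joins the two half costs. The
  dummy and sign constraints are the diagonal constraints at vertices and at labels.\<close>

lemma project_dual_feasible:
  assumes "lap_dual_feasible R d"
  shows "ilap_dual_feasible P (project_dual P d)"
proof -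
  obtain a b where d: "d = (a, b)" by (cases d)
  note f = assms[unfolded d lap_dual_feasible_reduction_iff]
  have "a $ v + b $ v + (a $ l + b $ l) \<le> cost P v l" if "v \<in> V" "l \<in> allowed P v - {dummy P}" for v l
  proof -
    have "a $ v + b $ l \<le> cost P v l / 2" "a $ l + b $ v \<le> cost P v l / 2" using f that by blast+
    then show ?thesis by linarith
  qed
  moreover have "l \<in> L" if "v \<in> V" "l \<in> allowed P v - {dummy P}" for v l
    using that allowed_proper by blast
  ultimately show ?thesis
    using f by (auto simp: d ilap_dual_feasible_def project_dual_def)
qed

lemma project_dual_objective:
  "ilap_dual_objective P (project_dual P d) = lap_dual_objective R d"
  by (auto simp: ilap_dual_objective_def lap_dual_objective_def project_dual_def
      sum_vertices_labels sum.distrib split: prod.splits)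

lemma lift_dual_feasible:
  assumes "ilap_dual_feasible P d"
  shows "lap_dual_feasible R (lift_dual d)"
proof -
  obtain a b where d: "d = (a, b)" by (cases d)
  note f = assms[unfolded d ilap_dual_feasible_def, simplified]
  \<comment> \<open>By disjointness \<open>b\<close> is 0 at vertices and \<open>a\<close> is 0 at
    proper labels, so each sum below reduces to the ILAP constraint on the remaining
    components.\<close>
  have "a $ v + b $ v \<le> cost P v (dummy P)" if "v \<in> V" for v
    using f that vertices_notin_labels(2)[OF that] by simp
  moreover have "a $ l + b $ l \<le> 0" if "l \<in> L" for l
    using f that labels_notin_vertices(2)[OF that] by simp
  moreover have "a $ v + b $ v + (a $ l + b $ l) \<le> cost P v l"
    if "v \<in> V" "l \<in> allowed P v - {dummy P}" for v l
  proof -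
    have l: "l \<in> L" using that allowed_proper by blast
    show ?thesis using f that vertices_notin_labels(2)[OF that(1)] labels_notin_vertices(2)[OF l] by simp
  qed
  ultimately show ?thesis
    using f by (fastforce simp: d lift_dual_def Let_def lap_dual_feasible_reduction_iff field_simps)
qed

text \<open>The two halves add up to \<open>a + b\<close>, which is \<open>a\<close> on vertices and
  \<open>b\<close> on proper labels.\<close>

lemma project_lift_dual:
  assumes "ilap_dual_feasible P d"
  shows "project_dual P (lift_dual d) = d"
proof -
  obtain a b where d: "d = (a, b)" by (cases d)
  note f = assms[unfolded d ilap_dual_feasible_def, simplified]
  have "a $ l = 0" if "l \<in> L" for l using f labels_notin_vertices(2)[OF that] by simp
  moreover have "b $ v = 0" if "v \<in> V" for v using f vertices_notin_labels(2)[OF that] by simp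
  ultimately show ?thesis
    using f by (auto simp: d project_dual_def lift_dual_def Let_def vec_eq_iff)
qed

lemma project_dual_image:
  "project_dual P ` {d. lap_dual_feasible R d} = {d. ilap_dual_feasible P d}"
proof (intro equalityI subsetI)
  fix d assume "d \<in> {d. ilap_dual_feasible P d}"
  then show "d \<in> project_dual P ` {d. lap_dual_feasible R d}"
    by (intro image_eqI[of _ _ "lift_dual d"])
      (simp_all add: project_lift_dual lift_dual_feasible)
qed (auto intro: project_dual_feasible)

section \<open>Transfer of optimizers and of their relative interiors\<close>

lemma project_primal_optimizers:
  "project_primal P ` lap_primal_optimizers R = ilap_primal_optimizers P"
  unfolding lap_primal_optimizers_def ilap_primal_optimizers_def
  by (rule arg_min_image) (rule project_primal_image project_primal_objective)+

lemma project_primal_rel_interior: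
  "project_primal P ` rel_interior (lap_primal_optimizers R) = rel_interior (ilap_primal_optimizers P)"
  unfolding lap_primal_optimizers_def ilap_primal_optimizers_def
  by (rule rel_interior_arg_min_image)
    (rule linear_project_primal linear_lap_primal_objective
        convex_lap_primal_feasible project_primal_image project_primal_objective)+

text \<open>Negating the objective turns the dual maximization into a minimization, to which the
  image argument applies.\<close>

lemma project_dual_optimizers:
  "project_dual P ` lap_dual_optimizers R = ilap_dual_optimizers P"
  unfolding lap_dual_optimizers_def ilap_dual_optimizers_def is_arg_max_iff_is_arg_min
  by (rule arg_min_image) (simp_all add: project_dual_image project_dual_objective)

lemma project_dual_rel_interior:
  "project_dual P ` rel_interior (lap_dual_optimizers R) = rel_interior (ilap_dual_optimizers P)"
  unfolding lap_dual_optimizers_def ilap_dual_optimizers_def is_arg_max_iff_is_arg_min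
  by (rule rel_interior_arg_min_image)
    (simp_all add: linear_project_dual linear_compose_neg[OF linear_lap_dual_objective]
      convex_lap_dual_feasible project_dual_image project_dual_objective)

end

theorem theorem5:
  fixes P :: "'a::finite ilap"
    and \<mu> \<mu>' :: "real ^ 'a ^ 'a"
    and \<alpha> \<beta> \<alpha>' \<beta>' :: "real ^ 'a"
  assumes "ilap_instance P"
    and "lap_primal_feasible (reduction P) \<mu>'"
    and "lap_dual_feasible (reduction P) (\<alpha>', \<beta>')"
    and "\<mu> = (\<chi> v l. if v \<in> vertices P \<and> l \<in> allowed P v
                    then (if l \<noteq> dummy P then (\<mu>' $ v $ l + \<mu>' $ l $ v) / 2 else \<mu>' $ v $ v)
                    else 0)"
    and "\<alpha> = (\<chi> v. if v \<in> vertices P then \<alpha>' $ v + \<beta>' $ v else 0)"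
    and "\<beta> = (\<chi> l. if l \<in> proper_labels P then \<alpha>' $ l + \<beta>' $ l else 0)"
  shows "ilap_primal_feasible P \<mu> \<and>
         ilap_dual_feasible P (\<alpha>, \<beta>) \<and>
         (\<mu>' \<in> lap_primal_optimizers (reduction P) \<longrightarrow> \<mu> \<in> ilap_primal_optimizers P) \<and>
         ((\<alpha>', \<beta>') \<in> lap_dual_optimizers (reduction P) \<longrightarrow> (\<alpha>, \<beta>) \<in> ilap_dual_optimizers P) \<and>
         (\<mu>' \<in> rel_interior (lap_primal_optimizers (reduction P)) \<longrightarrow>
            \<mu> \<in> rel_interior (ilap_primal_optimizers P)) \<and>
         ((\<alpha>', \<beta>') \<in> rel_interior (lap_dual_optimizers (reduction P)) \<longrightarrow>
            (\<alpha>, \<beta>) \<in> rel_interior (ilap_dual_optimizers P))"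
proof -
  have \<mu>: "\<mu> = project_primal P \<mu>'" by (simp add: assms(4) project_primal_def)
  have \<alpha>\<beta>: "(\<alpha>, \<beta>) = project_dual P (\<alpha>', \<beta>')" by (simp add: assms(5,6) project_dual_def)
  show ?thesis
    \<comment> \<open>Each claim on optimizers or relative interiors now says that the image of a
      point of a set lies in the image of that set.\<close>
    unfolding \<mu> \<alpha>\<beta>
    using project_primal_feasible[OF assms(1,2)] project_dual_feasible[OF assms(1,3)]
      project_primal_optimizers[OF assms(1)] project_primal_rel_interior[OF assms(1)]
      project_dual_optimizers[OF assms(1)] project_dual_rel_interior[OF assms(1)]
    by blast
qed

end
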